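(* Let $n\ge 1$ and $m\ge 1$ be integers, let $N:=(m+1)n$ and $\zeta_N:=\exp(2\pi\sqrt{-1}/N)$. Define $$\mathcal T_n(\zeta_N;m):=\sum_{1\le i_1<i_2<\cdots<i_m\le n}\frac{1}{(1-\zeta_N^{(m+1)i_1-1})(1-\zeta_N^{(m+1)i_2-2})\cdots(1-\zeta_N^{(m+1)i_m-m})}.$$ Then $$\mathcal T_n(\zeta_{(m+1)n};m)=\frac{1}{m+1}\binom{n}{m}.$$
   Context: An empty sum is $0$; $\binom{n}{m}=0$ when $m>n$. *)

theory Defs
  imports Complex_Main "HOL-Library.FuncSet"
begin

text \<open>
  Index tuples \<open>1 \<le> i\<^sub>1 < \<dots> < i\<^sub>m \<le> n\<close>, as functions on \<open>{1..m}\<close>. Extensionality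
  (\<open>i j = undefined\<close> outside \<open>{1..m}\<close>) makes each tuple correspond to exactly one function.
\<close>

definition incr_tuples :: "nat \<Rightarrow> nat \<Rightarrow> (nat \<Rightarrow> nat) set" where
  "incr_tuples m n = {i \<in> {1..m} \<rightarrow>\<^sub>E {1..n}. strict_mono_on {1..m} i}"

definition zeta :: "nat \<Rightarrow> complex" where
  "zeta N = exp (2 * of_real pi * \<i> / of_nat N)"

text \<open>Integer exponents, so that the subtraction is not truncated.\<close>

definition T_sum :: "nat \<Rightarrow> complex \<Rightarrow> nat \<Rightarrow> complex" where
  "T_sum n q m =
     (\<Sum>i\<in>incr_tuples m n.
        1 / (\<Prod>j\<in>{1..m}. 1 - q powi ((int m + 1) * int (i j) - int j)))"

end

theory Submission
  imports Defs "HOL-Computational_Algebra.Polynomial"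
begin

text \<open>
  Put \<open>a\<^sub>0 = 0\<close>, \<open>a\<^sub>j = (m + 1) i\<^sub>j - j\<close> and \<open>x\<^sub>j = q ^ a\<^sub>j\<close>. Modulo \<open>N\<close>, the points
  \<open>a\<^sub>0 < a\<^sub>1 < \<dots> < a\<^sub>m\<close> form a cyclic configuration all of whose consecutive gaps are congruent
  to \<open>m\<close> modulo \<open>m + 1\<close>, and every such configuration containing the base point \<open>0\<close> arises
  from exactly one index tuple. The summand is the product of \<open>1 / (1 - x\<^sub>j / x\<^sub>0)\<close> over \<open>j \<noteq> 0\<close>.
  Moving the base point to \<open>a\<^sub>1\<close> permutes the index tuples, so \<open>x\<^sub>0\<close> may be replaced by any
  \<open>x\<^sub>k\<close> without changing the sum over all tuples. Averaging over \<open>k\<close> and using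
  \<open>(\<Sum>k. \<Prod>j\<noteq>k. 1 / (1 - x\<^sub>j / x\<^sub>k)) = 1\<close> (Lagrange interpolation of the constant \<open>1\<close>) leaves
  the number of tuples divided by \<open>m + 1\<close>.
\<close>

section \<open>Lagrange interpolation of the constant 1\<close>

text \<open>The difference of the two sides has degree below \<open>card A\<close> but vanishes at
  the \<open>card A\<close> distinct nodes, so it is zero.\<close>

lemma sum_Lagrange_basis_poly:
  fixes y :: "'a \<Rightarrow> 'b :: field"
  assumes fin: "finite A" and ne: "A \<noteq> {}" and inj: "inj_on y A"
  shows "(\<Sum>k\<in>A. \<Prod>j\<in>A - {k}. smult (inverse (y k - y j)) [:- y j, 1:]) = 1"
    (is "(\<Sum>k\<in>A. ?L k) = 1")
proof (rule ccontr)
  let ?p = "(\<Sum>k\<in>A. ?L k) - 1"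
  assume "(\<Sum>k\<in>A. ?L k) \<noteq> 1"
  then have nz: "?p \<noteq> 0" by simp
  have "degree (?L k) \<le> card A - 1" if "k \<in> A" for k
  proof -
    have "degree (?L k) \<le> (\<Sum>j\<in>A - {k}. degree (smult (inverse (y k - y j)) [:- y j, 1:]))"
      by (rule degree_prod_sum_le[unfolded o_def]) (use fin in simp)
    also have "\<dots> \<le> (\<Sum>j\<in>A - {k}. 1)"
      by (rule sum_mono) (auto intro: order_trans[OF degree_smult_le])
    finally show ?thesis using fin that by simp
  qed
  then have "degree ?p \<le> card A - 1"
    by (intro degree_diff_le degree_sum_le fin) auto
  then have deg: "degree ?p < card A"
    using fin ne by (simp add: card_gt_0_iff order_le_less_trans)
  have factor: "poly (smult c [:- a, 1:]) z = c * (z - a)" for a c z :: 'b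
    by (simp add: algebra_simps)
  have root: "poly ?p (y l) = 0" if l: "l \<in> A" for l
  proof -
    have "poly (?L k) (y l) = (if k = l then 1 else 0)" if k: "k \<in> A" for k
    proof (cases "k = l")
      case True
      have "y l \<noteq> y j" if "j \<in> A - {l}" for j
        using inj l that by (auto dest: inj_onD)
      then show ?thesis unfolding True poly_prod factor if_P[OF refl]
        by (intro prod.neutral) auto
    next
      case False
      then show ?thesis using l fin by (auto simp: poly_prod intro!: prod_zero bexI[of _ l])
    qed
    then have "poly (\<Sum>k\<in>A. ?L k) (y l) = (\<Sum>k\<in>A. if k = l then 1 else 0)"
      by (simp add: poly_sum)
    then show ?thesis using fin l by simp
  qed
  have "card A = card (y ` A)" using inj by (simp add: card_image)
  also have "\<dots> \<le> card {z. poly ?p z = 0}"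
    by (rule card_mono[OF poly_roots_finite[OF nz]]) (use root in auto)
  also have "\<dots> \<le> degree ?p" by (rule card_poly_roots_bound[OF nz])
  finally show False using deg by simp
qed

text \<open>Interpolation with the nodes \<open>1 / x k\<close>, evaluated at 0: a basis factor
  becomes \<open>(0 - 1 / x j) / (1 / x k - 1 / x j) = 1 / (1 - x j / x k)\<close>.\<close>

lemma sum_prod_inverse_one_minus_quotient:
  fixes x :: "'a \<Rightarrow> 'b :: field"
  assumes fin: "finite A" and ne: "A \<noteq> {}" and inj: "inj_on x A"
    and nz: "\<And>k. k \<in> A \<Longrightarrow> x k \<noteq> 0"
  shows "(\<Sum>k\<in>A. \<Prod>j\<in>A - {k}. 1 / (1 - x j / x k)) = 1"
proof -
  have "inj_on (\<lambda>k. inverse (x k)) A" using inj by (simp add: inj_on_def)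
  from arg_cong[OF sum_Lagrange_basis_poly[OF fin ne this], of "\<lambda>p. poly p 0"]
  have "(\<Sum>k\<in>A. \<Prod>j\<in>A - {k}. - (inverse (inverse (x k) - inverse (x j)) * inverse (x j))) = 1"
    by (simp add: poly_sum poly_prod)
  moreover have "1 / (1 - x j / x k)
      = - (inverse (inverse (x k) - inverse (x j)) * inverse (x j))"
    if "k \<in> A" "j \<in> A - {k}" for k j
  proof -
    have "x j \<noteq> x k" using inj that by (auto dest: inj_onD)
    then show ?thesis using nz[of j] nz[of k] that by (auto simp: field_simps)
  qed
  ultimately show ?thesis by simp
qed

section \<open>Counting the index tuples\<close>

lemma finite_incr_tuples: "finite (incr_tuples m n)"
  unfolding incr_tuples_def by (rule finite_subset[of _ "{1..m} \<rightarrow>\<^sub>E {1..n}"]) (auto intro: finite_PiE)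

text \<open>An increasing tuple is the sorted enumeration of its image, so tuples correspond to
  \<open>m\<close>-element subsets of \<open>{1..n}\<close>.\<close>

lemma card_incr_tuples: "card (incr_tuples m n) = n choose m"
proof -
  have "bij_betw (\<lambda>i. i ` {1..m}) (incr_tuples m n) {S. S \<subseteq> {1..n} \<and> card S = m}"
  proof (rule bij_betwI')
    fix i i' assume ii: "i \<in> incr_tuples m n" "i' \<in> incr_tuples m n"
    have srt: "sorted (map f [1..<Suc m]) \<and> distinct (map f [1..<Suc m])"
      if "f \<in> incr_tuples m n" for f
    proof -
      have mono: "strict_mono_on {1..m} f" using that by (simp add: incr_tuples_def)
      have "sorted_wrt (<) (map f [1..<Suc m])"
        unfolding sorted_wrt_map
        by (rule sorted_wrt_mono_rel[OF _ sorted_wrt_upt]) (use mono in \<open>auto simp: strict_mono_on_def\<close>)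
      then show ?thesis by (simp only: strict_sorted_iff)
    qed
    show "i ` {1..m} = i' ` {1..m} \<longleftrightarrow> i = i'"
    proof
      assume "i ` {1..m} = i' ` {1..m}"
      then have "set (map i [1..<Suc m]) = set (map i' [1..<Suc m])"
        by (simp add: atLeastLessThanSuc_atLeastAtMost del: upt_Suc)
      then have "map i [1..<Suc m] = map i' [1..<Suc m]"
        using srt[OF ii(1)] srt[OF ii(2)] sorted_distinct_set_unique by blast
      then have "\<forall>j\<in>{1..m}. i j = i' j" by (auto simp del: upt_Suc)
      then show "i = i'"
        using ii by (intro PiE_ext[of i "{1..m}" "\<lambda>_. {1..n}" i']) (auto simp: incr_tuples_def)
    qed simp
  next
    fix i assume "i \<in> incr_tuples m n"
    then have "i \<in> {1..m} \<rightarrow>\<^sub>E {1..n}" "inj_on i {1..m}"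
      by (auto simp: incr_tuples_def strict_mono_on_imp_inj_on)
    then show "i ` {1..m} \<in> {S. S \<subseteq> {1..n} \<and> card S = m}"
      by (auto simp: card_image)
  next
    fix S assume S: "S \<in> {S. S \<subseteq> {1..n} \<and> card S = m}"
    then have fin: "finite S" and card: "card S = m"
      by (auto intro: finite_subset)
    let ?l = "sorted_list_of_set S"
    \<comment> \<open>Lists are indexed from 0, tuples from 1. The restricted abstraction provides
      extensionality.\<close>
    let ?i = "\<lambda>j\<in>{1..m}. ?l ! (j - 1)"
    have len: "length ?l = m" using card by simp
    have set: "set ?l = S" using fin by simp
    have "?i ` {1..m} = (\<lambda>j. ?l ! j) ` {..<m}"
    proof -
      have "{..<m} = (\<lambda>j. j - 1) ` {1..m}"
        by (auto simp: image_iff intro!: bexI[of _ "Suc _"])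
      then show ?thesis by (simp add: image_image)
    qed
    then have img: "?i ` {1..m} = S"
      using nth_image[of m ?l] len set by (simp add: lessThan_atLeast0)
    have "?l ! a < ?l ! b" if "a < b" "b < m" for a b
      using sorted_wrt_nth_less[OF strict_sorted_list_of_set that(1), of S] len that by simp
    then have "strict_mono_on {1..m} ?i"
      by (auto simp: strict_mono_on_def)
    moreover have "?i \<in> {1..m} \<rightarrow>\<^sub>E {1..n}"
      using img S by fastforce
    ultimately show "\<exists>i\<in>incr_tuples m n. S = i ` {1..m}"
      using img by (intro bexI[of _ ?i]) (auto simp: incr_tuples_def)
  qed
  then have "card (incr_tuples m n) = card {S. S \<subseteq> {1..n} \<and> card S = m}"
    by (rule bij_betw_same_card)
  then show ?thesis by (simp add: n_subsets)
qed

section \<open>Powers of the root of unity\<close>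

lemma zeta_power_eq_cis: "zeta N ^ k = cis (2 * pi * real k / real N)"
proof -
  have "zeta N = cis (2 * pi / real N)"
    by (simp add: zeta_def cis_conv_exp mult_ac)
  then show ?thesis by (simp add: Complex.DeMoivre mult_ac)
qed

lemma zeta_nonzero: "zeta N \<noteq> 0"
  by (simp add: zeta_def)

lemma zeta_power_self: "N > 0 \<Longrightarrow> zeta N ^ N = 1"
  by (simp add: zeta_power_eq_cis)

lemma inj_on_zeta_power: "N > 0 \<Longrightarrow> inj_on (\<lambda>k. zeta N ^ k) {..<N}"
  using bij_betw_roots_unity[of N] by (simp add: zeta_power_eq_cis bij_betw_def)

lemma inj_on_zeta_powi:
  assumes "N > 0"
  shows "inj_on (\<lambda>t. zeta N powi t) {0..<int N}"
proof (rule inj_onI)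
  fix s t assume st: "s \<in> {0..<int N}" "t \<in> {0..<int N}" and "zeta N powi s = zeta N powi t"
  then have "zeta N ^ nat s = zeta N ^ nat t" by (simp add: power_int_def)
  then have "nat s = nat t"
    using st by (intro inj_onD[OF inj_on_zeta_power[OF assms]]) (auto simp: nat_less_iff)
  then show "s = t" using st by (simp add: nat_eq_iff)
qed

section \<open>Positions on the cycle and their rotation\<close>

text \<open>The base point needs its own case, because \<open>i 0\<close> is
  \<open>undefined\<close> for an extensional tuple.\<close>

definition pos :: "nat \<Rightarrow> (nat \<Rightarrow> nat) \<Rightarrow> nat \<Rightarrow> int" where
  "pos m i j = (if j = 0 then 0 else (int m + 1) * int (i j) - int j)"

text \<open>Subtracting \<open>pos m i 1\<close> from all positions modulo
  \<open>(m + 1) * n\<close> makes the first point the new base. The old base becomes the last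
  point, at \<open>(m + 1) * n - pos m i 1 = (m + 1) * (n + 1 - i 1) - m\<close>, whence the entry
  \<open>n + 1 - i 1\<close>.\<close>

definition rot :: "nat \<Rightarrow> nat \<Rightarrow> (nat \<Rightarrow> nat) \<Rightarrow> nat \<Rightarrow> nat" where
  "rot m n i = (\<lambda>j\<in>{1..m}. if j = m then n + 1 - i 1 else i (j + 1) - i 1)"

lemma incr_tuples_range: "i \<in> incr_tuples m n \<Longrightarrow> j \<in> {1..m} \<Longrightarrow> i j \<in> {1..n}"
  by (auto simp: incr_tuples_def PiE_iff)

lemma incr_tuples_less: "i \<in> incr_tuples m n \<Longrightarrow> 1 \<le> j \<Longrightarrow> j < k \<Longrightarrow> k \<le> m \<Longrightarrow> i j < i k"
  by (auto simp: incr_tuples_def strict_mono_on_def)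

lemma incr_tuples_first_le:
  "i \<in> incr_tuples m n \<Longrightarrow> 1 \<le> j \<Longrightarrow> j \<le> m \<Longrightarrow> i 1 \<le> i j"
  using incr_tuples_less[of i m n 1 j] by (cases "j = 1") auto

lemma rot_in_incr_tuples:
  assumes i: "i \<in> incr_tuples m n" and m: "m \<ge> 1"
  shows "rot m n i \<in> incr_tuples m n"
proof -
  have i1: "i 1 \<in> {1..n}" using incr_tuples_range[OF i] m by simp
  have "rot m n i j \<in> {1..n}" if "j \<in> {1..m}" for j
    using that i1 incr_tuples_range[OF i, of "j + 1"] incr_tuples_less[OF i, of 1 "j + 1"]
    by (auto simp: rot_def)
  moreover have "rot m n i j < rot m n i k" if "j \<in> {1..m}" "k \<in> {1..m}" "j < k" for j k
    using that i1 incr_tuples_range[OF i, of "j + 1"] incr_tuples_less[OF i, of 1 "j + 1"]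
      incr_tuples_less[OF i, of "j + 1" "k + 1"]
    by (auto simp: rot_def)
  moreover have "rot m n i \<in> extensional {1..m}" by (simp add: rot_def)
  ultimately show ?thesis
    by (auto simp: incr_tuples_def PiE_iff strict_mono_on_def)
qed

text \<open>The entry at \<open>m\<close> reveals \<open>i 1\<close>; adding \<open>i 1\<close> to
  the other entries recovers the rest of the tuple.\<close>

lemma inj_on_rot:
  assumes m: "m \<ge> 1"
  shows "inj_on (rot m n) (incr_tuples m n)"
proof (rule inj_onI)
  fix i i' assume i: "i \<in> incr_tuples m n" and i': "i' \<in> incr_tuples m n"
    and eq: "rot m n i = rot m n i'"
  have first: "i 1 = i' 1"
    using fun_cong[OF eq, of m] m incr_tuples_range[OF i, of 1] incr_tuples_range[OF i', of 1]
    by (simp add: rot_def) linarith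
  have "i j = i' j" if j: "j \<in> {1..m}" for j
  proof (cases "j = 1")
    case True
    then show ?thesis using first by simp
  next
    case False
    then show ?thesis
      using fun_cong[OF eq, of "j - 1"] j first
        incr_tuples_first_le[OF i, of j] incr_tuples_first_le[OF i', of j]
      by (auto simp: rot_def split: if_splits)
  qed
  then show "i = i'"
    using i i' by (intro PiE_ext[of i "{1..m}" "\<lambda>_. {1..n}" i']) (auto simp: incr_tuples_def)
qed

text \<open>An injective self-map of a finite set is onto, so no inverse rotation has to be
  constructed.\<close>

lemma bij_betw_rot:
  "m \<ge> 1 \<Longrightarrow> bij_betw (rot m n) (incr_tuples m n) (incr_tuples m n)"
  by (auto intro!: bij_betw_imageI inj_on_rot endo_inj_surj[OF finite_incr_tuples]
      rot_in_incr_tuples)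

text \<open>The multiple of \<open>m + 1\<close> grows by at least \<open>m + 1\<close>, while the
  subtracted index grows by at most \<open>m\<close>.\<close>

lemma pos_less:
  assumes i: "i \<in> incr_tuples m n" and "j < k" "k \<le> m"
  shows "pos m i j < pos m i k"
proof -
  \<comment> \<open>Giving index 0 the value 0 lets one formula cover the base point too.\<close>
  define b where "b = (if j = 0 then 0 else int (i j))"
  have "b < int (i k)"
    using incr_tuples_less[OF i, of j k] incr_tuples_range[OF i, of k] assms
    by (auto simp: b_def)
  then have "(int m + 1) * (b + 1) \<le> (int m + 1) * int (i k)"
    by (intro mult_left_mono) auto
  moreover have "pos m i j = (int m + 1) * b - int j" "pos m i k = (int m + 1) * int (i k) - int k"
    using assms by (auto simp: pos_def b_def)
  ultimately show ?thesis using assms by (simp add: algebra_simps)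
qed

lemma pos_range:
  assumes i: "i \<in> incr_tuples m n" and "n \<ge> 1" "j \<le> m"
  shows "pos m i j \<in> {0..<int ((m + 1) * n)}"
proof (cases "j = 0")
  case True
  then show ?thesis using assms by (simp add: pos_def add_pos_nonneg)
next
  case False
  then have "i j \<in> {1..n}" using incr_tuples_range[OF i] assms by simp
  then have "(int m + 1) * int (i j) \<le> (int m + 1) * int n"
    by (intro mult_left_mono) auto
  moreover have "pos m i 0 < pos m i j" using pos_less[OF i] False assms by simp
  ultimately show ?thesis using False by (simp add: pos_def algebra_simps)
qed

lemma inj_on_pos: "i \<in> incr_tuples m n \<Longrightarrow> inj_on (pos m i) {..m}"
  by (rule linorder_inj_onI) (auto dest: pos_less)

lemma pos_rot:
  assumes i: "i \<in> incr_tuples m n" and m: "m \<ge> 1" and j: "j \<le> m"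
  shows "pos m (rot m n i) j =
    (if j = m then int ((m + 1) * n) - pos m i 1 else pos m i (j + 1) - pos m i 1)"
proof -
  have i1: "i 1 \<in> {1..n}" using incr_tuples_range[OF i] m by simp
  have "i 1 \<le> i (j + 1)" if "j < m" using incr_tuples_first_le[OF i, of "j + 1"] that by simp
  then show ?thesis
    using i1 j m by (auto simp: pos_def rot_def of_nat_diff algebra_simps)
qed

section \<open>Moving the base point\<close>

text \<open>The summand seen from base point \<open>k\<close>; for \<open>k = 0\<close> the
  denominator \<open>q powi pos m i k\<close> is 1 and the original summand returns.\<close>

definition rterm :: "complex \<Rightarrow> nat \<Rightarrow> (nat \<Rightarrow> nat) \<Rightarrow> nat \<Rightarrow> complex" where
  "rterm q m i k = (\<Prod>j\<in>{..m} - {k}. 1 / (1 - q powi pos m i j / q powi pos m i k))"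

lemma T_sum_eq_rterm: "T_sum n q m = (\<Sum>i\<in>incr_tuples m n. rterm q m i 0)"
proof -
  have set: "{..m} - {0} = {1..m}" by auto
  have "1 / (\<Prod>j\<in>{1..m}. 1 - q powi ((int m + 1) * int (i j) - int j)) = rterm q m i 0" for i
    unfolding rterm_def set
    by (simp add: pos_def prod_dividef)
  then show ?thesis by (simp add: T_sum_def)
qed

text \<open>Rotation divides every power by the common factor \<open>q powi pos m i 1\<close>, which
  cancels in the quotients; only a cyclic relabelling of the points remains.\<close>

lemma rterm_rot:
  assumes i: "i \<in> incr_tuples m n" and m: "m \<ge> 1" and k: "k < m"
    and q: "q \<noteq> 0" "q ^ ((m + 1) * n) = 1"
  shows "rterm q m (rot m n i) k = rterm q m i (Suc k)"
proof -
  \<comment> \<open>The relabelling is the successor modulo \<open>m + 1\<close>.\<close>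
  define s where "s j = (if j = m then 0 else Suc j)" for j
  have powi: "q powi pos m (rot m n i) j = q powi pos m i (s j) / q powi pos m i 1" if "j \<le> m" for j
  proof -
    \<comment> \<open>This handles \<open>j = m\<close>, where the wrap-around adds
      \<open>(m + 1) * n\<close> to the exponent.\<close>
    have "q powi int ((m + 1) * n) = 1" using q(2) by (simp only: power_int_of_nat)
    then show ?thesis
      using q(1) pos_rot[OF i m that] by (auto simp: power_int_diff s_def pos_def[of m i 0])
  qed
  have "bij_betw s ({..m} - {k}) ({..m} - {Suc k})"
    by (rule bij_betw_byWitness[where f' = "\<lambda>j. if j = 0 then m else j - 1"])
      (use k in \<open>auto simp: s_def\<close>)
  then have "rterm q m i (Suc k) =
      (\<Prod>j\<in>{..m} - {k}. 1 / (1 - q powi pos m i (s j) / q powi pos m i (Suc k)))"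
    unfolding rterm_def by (rule prod.reindex_bij_betw[symmetric])
  also have "\<dots> = rterm q m (rot m n i) k"
    unfolding rterm_def
    by (rule prod.cong) (use k q(1) in \<open>auto simp: powi s_def\<close>)
  finally show ?thesis ..
qed

text \<open>Raising \<open>k\<close> by one amounts to rotating the tuple, and rotation only
  permutes the range of summation.\<close>

lemma sum_rterm_const:
  assumes m: "m \<ge> 1" and "k \<le> m" and q: "q \<noteq> 0" "q ^ ((m + 1) * n) = 1"
  shows "(\<Sum>i\<in>incr_tuples m n. rterm q m i k) = T_sum n q m"
  using \<open>k \<le> m\<close>
proof (induction k)
  case 0
  show ?case by (simp add: T_sum_eq_rterm)
next
  case (Suc k)
  have "(\<Sum>i\<in>incr_tuples m n. rterm q m i (Suc k)) = (\<Sum>i\<in>incr_tuples m n. rterm q m (rot m n i) k)"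
    using Suc.prems by (intro sum.cong refl rterm_rot[symmetric] m q) auto
  also have "\<dots> = (\<Sum>i\<in>incr_tuples m n. rterm q m i k)"
    by (rule sum.reindex_bij_betw[OF bij_betw_rot[OF m]])
  finally show ?case using Suc by simp
qed

theorem theorem2:
  fixes n m :: nat
  assumes "n \<ge> 1" and "m \<ge> 1"
  shows "T_sum n (zeta ((m + 1) * n)) m = 1 / (of_nat m + 1) * of_nat (n choose m)"
proof -
  define N where "N = (m + 1) * n"
  let ?q = "zeta N"
  have N: "N > 0" using assms by (simp add: N_def)
  have q: "?q \<noteq> 0" "?q ^ ((m + 1) * n) = 1"
    using zeta_nonzero zeta_power_self[OF N] by (simp_all add: N_def)
  have one: "(\<Sum>k\<in>{..m}. rterm ?q m i k) = 1" if i: "i \<in> incr_tuples m n" for i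
  proof -
    \<comment> \<open>Distinct positions within one period give distinct powers of
      \<open>?q\<close>, as the interpolation identity requires.\<close>
    have "pos m i ` {..m} \<subseteq> {0..<int N}"
      using pos_range[OF i assms(1)] by (auto simp: N_def)
    then have "inj_on (\<lambda>j. ?q powi pos m i j) {..m}"
      using comp_inj_on[OF inj_on_pos[OF i] inj_on_subset[OF inj_on_zeta_powi[OF N]]]
      by (simp add: o_def)
    then show ?thesis
      unfolding rterm_def by (intro sum_prod_inverse_one_minus_quotient) (auto simp: q)
  qed
  have "of_nat (m + 1) * T_sum n ?q m = (\<Sum>k\<in>{..m}. \<Sum>i\<in>incr_tuples m n. rterm ?q m i k)"
    using sum_rterm_const[OF assms(2) _ q] by simp
  also have "\<dots> = (\<Sum>i\<in>incr_tuples m n. \<Sum>k\<in>{..m}. rterm ?q m i k)"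
    by (rule sum.swap)
  also have "\<dots> = of_nat (n choose m)"
    by (simp add: one card_incr_tuples)
  finally have "(of_nat m + 1) * T_sum n ?q m = of_nat (n choose m)"
    by (simp add: add.commute)
  moreover have "(of_nat m + 1 :: complex) \<noteq> 0"
    using of_nat_neq_0[of m] by (simp add: add.commute)
  ultimately show ?thesis
    by (simp add: N_def field_simps)
qed

end
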